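(* Let $V^h$, $(\cdot,\cdot)$, $\|\cdot\|$, $A$, $\delta>0$ be as in the context, so that $A=A^*\ge\delta I$ on $V^h$. Let $T>0$, $\phi,\psi\in V^h$, and let $\beta:[0,T]\to\mathbb{R}$ be a differentiable function with $$\beta(t)>0,\qquad \frac{d\beta}{dt}(t)\ge 0,\quad 0\le t\le T,\qquad \beta(T)=1 .$$ Let $w:[0,T]\to V^h$ and $\varphi\in V^h$ be the solution of the inverse problem $$\frac{dw}{dt}+Aw=\beta(t)\varphi,\quad 0<t\le T,\qquad w(0)=\phi,\qquad w(T)=\psi .$$ Given an arbitrary $\varphi^0\in V^h$, define iterates for $k=0,1,\dots$ as follows: given $\varphi^k$, the function $w^k:[0,T]\to V^h$ is the solution of $$\frac{dw^{k}}{dt}+Aw^{k}=\beta(t)\varphi^{k},\quad 0<t\le T,\qquad w^{k}(0)=\phi,$$ and $$\varphi^{k+1}=\frac{dw^{k}}{dt}(T)+A\psi .$$ Then the iterative process converges linearly at the rate $$\varrho=1-\beta(0)\left(1-\exp(-\delta T)\right),$$ and for all $k=0,1,\dots$ the following estimate holds: $$\|\varphi^{k+1}-\varphi\|\le\varrho\,\|\varphi^{k}-\varphi\|.$$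
   Context: Let $\Omega\subset\mathbb{R}^2$ be a bounded polygon, $(u,v)=\int_\Omega uv\,d\boldsymbol{x}$ and $\|u\|=(u,u)^{1/2}$ the $L_2(\Omega)$ scalar product and norm. Let $k,c$ be functions on $\Omega$ with $0<k_1\le k(\boldsymbol{x})\le k_2$, $c(\boldsymbol{x})\ge 0$, and $\mu$ a function on $\partial\Omega$ with $\mu(\boldsymbol{x})\ge\mu_1>0$, and let $$a(u,v)=\int_\Omega\left(k\,\mathrm{grad}\,u\cdot\mathrm{grad}\,v+c\,uv\right)d\boldsymbol{x}+\int_{\partial\Omega}\mu\,uv\,d\boldsymbol{x}$$ (assumed well defined). $V^h\subset H^1(\Omega)$ is a finite-dimensional (finite element) subspace with the $L_2(\Omega)$ scalar product, and $A:V^h\to V^h$ is defined by $(Ay,v)=a(y,v)$ for all $y,v\in V^h$. Here $\delta>0$ is a constant with $a(u,u)\ge\delta\|u\|^2$, so $A=A^*\ge\delta I$ on $V^h$, where $I$ is the identity operator. The inverse problem is assumed to be well-posed. *)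

theory Defs
  imports "HOL-Analysis.Analysis"
begin

section \<open>The Hilbert space of square-integrable functions on the plane\<close>

definition square_integrable :: "(real^2 \<Rightarrow> real) \<Rightarrow> bool" where
  "square_integrable f \<longleftrightarrow>
     f \<in> borel_measurable lebesgue \<and> integrable lebesgue (\<lambda>x. (f x)\<^sup>2)"

lemma square_integrable_mult:
  assumes "square_integrable f" "square_integrable g"
  shows "integrable lebesgue (\<lambda>x. f x * g x)"
proof (rule Bochner_Integration.integrable_bound)
  show "integrable lebesgue (\<lambda>x. (f x)\<^sup>2 + (g x)\<^sup>2)"
    using assms by (auto simp: square_integrable_def)
  show "(\<lambda>x. f x * g x) \<in> borel_measurable lebesgue"
    using assms by (auto simp: square_integrable_def)
  have "\<bar>a * b\<bar> \<le> a\<^sup>2 + b\<^sup>2" for a b :: real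
  proof -
    have "2 * (\<bar>a\<bar> * \<bar>b\<bar>) \<le> \<bar>a\<bar>\<^sup>2 + \<bar>b\<bar>\<^sup>2"
      using sum_squares_bound[of "\<bar>a\<bar>" "\<bar>b\<bar>"] by simp
    moreover have "0 \<le> \<bar>a\<bar> * \<bar>b\<bar>" by simp
    ultimately show ?thesis unfolding abs_mult power2_abs by linarith
  qed
  then show "AE x in lebesgue. norm (f x * g x) \<le> norm ((f x)\<^sup>2 + (g x)\<^sup>2)"
    by (intro always_eventually) (simp add: order_trans[OF _ abs_ge_self])
qed

lemma square_integrable_zero: "square_integrable (\<lambda>x. 0)"
  by (simp add: square_integrable_def)

lemma square_integrable_add:
  assumes "square_integrable f" "square_integrable g"
  shows "square_integrable (\<lambda>x. f x + g x)"
proof -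
  have "(\<lambda>x. (f x + g x)\<^sup>2) = (\<lambda>x. (f x)\<^sup>2 + (g x)\<^sup>2 + 2 * (f x * g x))"
    by (auto simp: power2_eq_square algebra_simps)
  moreover have "integrable lebesgue (\<lambda>x. (f x)\<^sup>2 + (g x)\<^sup>2 + 2 * (f x * g x))"
    using assms square_integrable_mult[OF assms] by (auto simp: square_integrable_def)
  ultimately show ?thesis
    using assms by (auto simp: square_integrable_def)
qed

lemma square_integrable_scale:
  "square_integrable f \<Longrightarrow> square_integrable (\<lambda>x. r * f x)"
  by (auto simp: square_integrable_def power_mult_distrib)

quotient_type l2 = "real^2 \<Rightarrow> real" / partial:
  "\<lambda>f g. square_integrable f \<and> square_integrable g \<and> (AE x in lebesgue. f x = g x)"
proof (rule part_equivpI)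
  show "\<exists>f. square_integrable f \<and> square_integrable f \<and> (AE x in lebesgue. f x = f x)"
    using square_integrable_zero by auto
  show "symp (\<lambda>f g. square_integrable f \<and> square_integrable g \<and> (AE x in lebesgue. f x = g x))"
    by (auto simp: symp_def)
  show "transp (\<lambda>f g. square_integrable f \<and> square_integrable g \<and> (AE x in lebesgue. f x = g x))"
    by (auto simp: transp_def)
qed

instantiation l2 :: real_inner
begin

lift_definition zero_l2 :: l2 is "\<lambda>x. 0"
  by (simp add: square_integrable_zero)

lift_definition plus_l2 :: "l2 \<Rightarrow> l2 \<Rightarrow> l2" is "\<lambda>f g x. f x + g x"
  by (auto simp: square_integrable_add)

lift_definition scaleR_l2 :: "real \<Rightarrow> l2 \<Rightarrow> l2" is "\<lambda>r f x. r * f x"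
  by (auto simp: square_integrable_scale)

definition uminus_l2 :: "l2 \<Rightarrow> l2" where
  "uminus_l2 u = (-1) *\<^sub>R u"

definition minus_l2 :: "l2 \<Rightarrow> l2 \<Rightarrow> l2" where
  "minus_l2 u v = u + (-1) *\<^sub>R v"

lift_definition inner_l2 :: "l2 \<Rightarrow> l2 \<Rightarrow> real" is "\<lambda>f g. LINT x|lebesgue. f x * g x"
  by (intro integral_cong_AE) (auto simp: square_integrable_def)

definition norm_l2 :: "l2 \<Rightarrow> real" where
  "norm_l2 u = sqrt (inner u u)"

definition dist_l2 :: "l2 \<Rightarrow> l2 \<Rightarrow> real" where
  "dist_l2 u v = norm (u - v)"

definition sgn_l2 :: "l2 \<Rightarrow> l2" where
  "sgn_l2 u = inverse (norm u) *\<^sub>R u"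

definition uniformity_l2 :: "(l2 \<times> l2) filter" where
  "uniformity_l2 = (INF e\<in>{0<..}. principal {(u, v). dist u v < e})"

definition open_l2 :: "l2 set \<Rightarrow> bool" where
  "open_l2 U \<longleftrightarrow> (\<forall>u\<in>U. eventually (\<lambda>(u', v). u' = u \<longrightarrow> v \<in> U) uniformity)"

instance
proof
  fix u v w :: l2 and r s :: real
  show "u + v + w = u + (v + w)"
    by transfer (auto intro!: square_integrable_add simp: algebra_simps)
  show "u + v = v + u"
    by transfer (auto intro!: square_integrable_add simp: algebra_simps)
  show "0 + u = u"
    by transfer auto
  show "- u + u = 0"
    unfolding uminus_l2_def
    by transfer (auto intro!: square_integrable_add square_integrable_scale square_integrable_zero
        simp: square_integrable_zero)
  show "u - v = u + - v"
    by (simp add: uminus_l2_def minus_l2_def)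
  show "r *\<^sub>R (u + v) = r *\<^sub>R u + r *\<^sub>R v"
    by transfer (auto intro!: square_integrable_add square_integrable_scale simp: algebra_simps)
  show "(r + s) *\<^sub>R u = r *\<^sub>R u + s *\<^sub>R u"
    by transfer (auto intro!: square_integrable_add square_integrable_scale simp: algebra_simps)
  show "r *\<^sub>R s *\<^sub>R u = (r * s) *\<^sub>R u"
    by transfer (auto intro!: square_integrable_scale simp: algebra_simps)
  show "1 *\<^sub>R u = u"
    by transfer auto
  show "dist u v = norm (u - v)"
    by (rule dist_l2_def)
  show "sgn u = inverse (norm u) *\<^sub>R u"
    by (simp add: sgn_l2_def)
  show "uniformity = (INF e\<in>{0<..}. principal {(u::l2, v). dist u v < e})"
    by (rule uniformity_l2_def)
  show "open U = (\<forall>u\<in>U. \<forall>\<^sub>F (u', v) in uniformity. u' = u \<longrightarrow> v \<in> U)" for U :: "l2 set"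
    by (rule open_l2_def)
  show "inner u v = inner v u"
    by transfer (simp add: mult.commute)
  show "inner (u + v) w = inner u w + inner v w"
    by transfer (simp add: distrib_right square_integrable_mult)
  show "inner (r *\<^sub>R u) v = r * inner u v"
    by transfer (simp add: mult.assoc)
  show "0 \<le> inner u u"
    by transfer simp
  show "inner u u = 0 \<longleftrightarrow> u = 0"
  proof transfer
    fix f assume f: "square_integrable f \<and> square_integrable f \<and> (AE x in lebesgue. f x = f x)"
    then have "(LINT x|lebesgue. f x * f x) = 0 \<longleftrightarrow> (AE x in lebesgue. f x * f x = 0)"
      by (intro integral_nonneg_eq_0_iff_AE square_integrable_mult) auto
    with f show "(LINT x|lebesgue. f x * f x) = 0 \<longleftrightarrow>
        square_integrable f \<and> square_integrable (\<lambda>x. 0) \<and> (AE x in lebesgue. f x = 0)"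
      by (simp add: square_integrable_zero)
  qed
  show "norm u = sqrt (inner u u)"
    by (rule norm_l2_def)
qed

end

text \<open>
  \<open>L\<^sub>2(\<Omega>)\<close> is identified with the closed subspace of the classes vanishing almost everywhere
  outside \<open>\<Omega>\<close> (extension by zero). The function \<^const>\<open>rep_l2\<close> picks a representative of a class.
\<close>

definition L2_on :: "(real^2) set \<Rightarrow> l2 set" where
  "L2_on \<Omega> = {u. AE x in lebesgue. x \<notin> \<Omega> \<longrightarrow> rep_l2 u x = 0}"

lemma inner_l2_on:
  assumes "\<Omega> \<in> sets lebesgue" "u \<in> L2_on \<Omega>"
  shows "inner u v = (LINT x:\<Omega>|lebesgue. rep_l2 u x * rep_l2 v x)"
proof -
  have sq: "square_integrable (rep_l2 u)" for u
    using Quotient_rep_reflp[OF Quotient_l2] by blast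
  have "inner u v = (LINT x|lebesgue. rep_l2 u x * rep_l2 v x)"
    by (simp add: inner_l2.rep_eq)
  also have "\<dots> = (LINT x|lebesgue. indicator \<Omega> x * (rep_l2 u x * rep_l2 v x))"
  proof (rule integral_cong_AE)
    have [measurable]: "rep_l2 u \<in> borel_measurable lebesgue"
      "rep_l2 v \<in> borel_measurable lebesgue"
      using sq by (auto simp: square_integrable_def)
    show "(\<lambda>x. rep_l2 u x * rep_l2 v x) \<in> borel_measurable lebesgue"
      "(\<lambda>x. indicator \<Omega> x * (rep_l2 u x * rep_l2 v x)) \<in> borel_measurable lebesgue"
      using assms(1) by measurable
    show "AE x in lebesgue. rep_l2 u x * rep_l2 v x
        = indicator \<Omega> x * (rep_l2 u x * rep_l2 v x)"
      using assms(2) by (auto simp: L2_on_def indicator_def elim!: eventually_mono)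
  qed
  finally show ?thesis
    by (simp add: set_lebesgue_integral_def)
qed

section \<open>Polygons and arc length on their boundary\<close>

definition edge :: "(real^2) list \<Rightarrow> nat \<Rightarrow> real \<Rightarrow> real^2" where
  "edge vs i = linepath (vs ! i) (vs ! (Suc i mod length vs))"

fun polygonal_path :: "(real^2) list \<Rightarrow> real \<Rightarrow> real^2" where
  "polygonal_path [] = linepath 0 0"
| "polygonal_path [p] = linepath p p"
| "polygonal_path [p, q] = linepath p q"
| "polygonal_path (p # q # r # vs) = linepath p q +++ polygonal_path (q # r # vs)"

definition polygon_path :: "(real^2) list \<Rightarrow> real \<Rightarrow> real^2" where
  "polygon_path vs = polygonal_path (vs @ [hd vs])"

definition simple_polygon :: "(real^2) list \<Rightarrow> bool" where
  "simple_polygon vs \<longleftrightarrow> 3 \<le> length vs \<and> simple_path (polygon_path vs)"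

definition polygon_interior :: "(real^2) list \<Rightarrow> (real^2) set" where
  "polygon_interior vs = inside (path_image (polygon_path vs))"

text \<open>
  Each edge carries the image of Lebesgue measure on the unit interval, scaled by the length of
  the edge; the completion makes integrals insensitive to changes on subsets of null sets.
\<close>

definition boundary_measure :: "(real^2) list \<Rightarrow> (real^2) measure" where
  "boundary_measure vs = completion (distr
     (density (count_space {..<length vs} \<Otimes>\<^sub>M restrict_space lborel {0..1})
        (\<lambda>(i, t). ennreal (dist (vs ! i) (vs ! (Suc i mod length vs)))))
     borel (\<lambda>(i, t). edge vs i t))"

section \<open>The Sobolev space of first order and traces\<close>

primrec times_differentiable :: "nat \<Rightarrow> (real^2 \<Rightarrow> real) \<Rightarrow> bool" where
  "times_differentiable 0 f \<longleftrightarrow> continuous_on UNIV f"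
| "times_differentiable (Suc n) f \<longleftrightarrow> (\<forall>x. f differentiable at x) \<and>
     (\<forall>v. times_differentiable n (\<lambda>x. frechet_derivative f (at x) v))"

definition smooth :: "(real^2 \<Rightarrow> real) \<Rightarrow> bool" where
  "smooth f \<longleftrightarrow> (\<forall>n. times_differentiable n f)"

definition grad :: "(real^2 \<Rightarrow> real) \<Rightarrow> real^2 \<Rightarrow> real^2" where
  "grad f x = (\<chi> i. frechet_derivative f (at x) (axis i 1))"

definition test_functions :: "(real^2) set \<Rightarrow> (real^2 \<Rightarrow> real) set" where
  "test_functions \<Omega> = {\<eta>. smooth \<eta> \<and> compact (closure {x. \<eta> x \<noteq> 0})
     \<and> closure {x. \<eta> x \<noteq> 0} \<subseteq> \<Omega>}"

definition has_weak_partial :: "(real^2) set \<Rightarrow> l2 \<Rightarrow> 2 \<Rightarrow> l2 \<Rightarrow> bool" where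
  "has_weak_partial \<Omega> u i g \<longleftrightarrow> g \<in> L2_on \<Omega> \<and>
     (\<forall>\<eta>\<in>test_functions \<Omega>. (LINT x:\<Omega>|lebesgue. rep_l2 u x * (grad \<eta> x $ i))
        = - (LINT x:\<Omega>|lebesgue. rep_l2 g x * \<eta> x))"

definition H1 :: "(real^2) set \<Rightarrow> l2 set" where
  "H1 \<Omega> = {u \<in> L2_on \<Omega>. \<forall>i. \<exists>g. has_weak_partial \<Omega> u i g}"

text \<open>
  A weak partial derivative in \<open>L\<^sub>2(\<Omega>)\<close> is unique as an element of \<^typ>\<open>l2\<close>, so the choice
  below only selects it.
\<close>

definition weak_grad :: "(real^2) set \<Rightarrow> l2 \<Rightarrow> real^2 \<Rightarrow> real^2" where
  "weak_grad \<Omega> u x = (\<chi> i. rep_l2 (SOME g. has_weak_partial \<Omega> u i g) x)"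

text \<open>
  The trace of \<open>u\<close> is the limit in \<open>L\<^sub>2(\<partial>\<Omega>)\<close> of the boundary values of smooth functions
  that converge to \<open>u\<close> in \<open>H\<^sup>1(\<Omega>)\<close>; it is determined up to null sets of the boundary measure.
\<close>

definition has_trace :: "(real^2) list \<Rightarrow> l2 \<Rightarrow> (real^2 \<Rightarrow> real) \<Rightarrow> bool" where
  "has_trace vs u g \<longleftrightarrow>
     g \<in> borel_measurable (boundary_measure vs) \<and>
     integrable (boundary_measure vs) (\<lambda>x. (g x)\<^sup>2) \<and>
     (\<exists>s. (\<forall>n. smooth (s n)) \<and>
        (\<lambda>n. LINT x:polygon_interior vs|lebesgue. (s n x - rep_l2 u x)\<^sup>2
            + (norm (grad (s n) x - weak_grad (polygon_interior vs) u x))\<^sup>2) \<longlonglongrightarrow> 0 \<and>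
        (\<lambda>n. LINT x|boundary_measure vs. (s n x - g x)\<^sup>2) \<longlonglongrightarrow> 0)"

definition boundary_trace :: "(real^2) list \<Rightarrow> l2 \<Rightarrow> real^2 \<Rightarrow> real" where
  "boundary_trace vs u = (SOME g. has_trace vs u g)"

section \<open>The bilinear form\<close>

definition form_integrable :: "(real^2) list \<Rightarrow> (real^2 \<Rightarrow> real) \<Rightarrow> (real^2 \<Rightarrow> real)
    \<Rightarrow> (real^2 \<Rightarrow> real) \<Rightarrow> l2 \<Rightarrow> l2 \<Rightarrow> bool" where
  "form_integrable vs k c \<mu> u v \<longleftrightarrow>
     set_integrable lebesgue (polygon_interior vs)
       (\<lambda>x. k x * (weak_grad (polygon_interior vs) u x \<bullet> weak_grad (polygon_interior vs) v x)
          + c x * rep_l2 u x * rep_l2 v x) \<and>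
     set_integrable (boundary_measure vs) (frontier (polygon_interior vs))
       (\<lambda>x. \<mu> x * boundary_trace vs u x * boundary_trace vs v x)"

definition form :: "(real^2) list \<Rightarrow> (real^2 \<Rightarrow> real) \<Rightarrow> (real^2 \<Rightarrow> real)
    \<Rightarrow> (real^2 \<Rightarrow> real) \<Rightarrow> l2 \<Rightarrow> l2 \<Rightarrow> real" where
  "form vs k c \<mu> u v =
     (LINT x:polygon_interior vs|lebesgue.
        k x * (weak_grad (polygon_interior vs) u x \<bullet> weak_grad (polygon_interior vs) v x)
          + c x * rep_l2 u x * rep_l2 v x) +
     (LINT x:frontier (polygon_interior vs)|boundary_measure vs.
        \<mu> x * boundary_trace vs u x * boundary_trace vs v x)"

section \<open>The evolution equation and the inverse problem\<close>

text \<open>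
  Continuity on the closed interval ties the initial value to the equation, which is only
  required for positive times. At the right end point the derivative is one-sided.
\<close>

definition solves_evolution :: "l2 set \<Rightarrow> (l2 \<Rightarrow> l2) \<Rightarrow> real \<Rightarrow> (real \<Rightarrow> real)
    \<Rightarrow> l2 \<Rightarrow> l2 \<Rightarrow> (real \<Rightarrow> l2) \<Rightarrow> bool" where
  "solves_evolution V A T \<beta> f \<phi> w \<longleftrightarrow>
     (\<forall>t\<in>{0..T}. w t \<in> V) \<and> continuous_on {0..T} w \<and> w 0 = \<phi> \<and>
     (\<forall>t\<in>{0<..T}. \<exists>w'. (w has_vector_derivative w') (at t within {0..T}) \<and>
        w' + A (w t) = \<beta> t *\<^sub>R f)"

definition solves_inverse :: "l2 set \<Rightarrow> (l2 \<Rightarrow> l2) \<Rightarrow> real \<Rightarrow> (real \<Rightarrow> real)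
    \<Rightarrow> l2 \<Rightarrow> l2 \<Rightarrow> (real \<Rightarrow> l2) \<Rightarrow> l2 \<Rightarrow> bool" where
  "solves_inverse V A T \<beta> \<phi> \<psi> w f \<longleftrightarrow>
     f \<in> V \<and> solves_evolution V A T \<beta> f \<phi> w \<and> w T = \<psi>"

text \<open>
  Well-posedness in the sense of Hadamard; as the problem is linear, continuous dependence on
  the data is stated as a Lipschitz bound.
\<close>

definition well_posed_inverse :: "l2 set \<Rightarrow> (l2 \<Rightarrow> l2) \<Rightarrow> real \<Rightarrow> (real \<Rightarrow> real) \<Rightarrow> bool" where
  "well_posed_inverse V A T \<beta> \<longleftrightarrow>
     (\<forall>\<phi>\<in>V. \<forall>\<psi>\<in>V. \<exists>w f. solves_inverse V A T \<beta> \<phi> \<psi> w f) \<and>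
     (\<forall>\<phi>\<in>V. \<forall>\<psi>\<in>V. \<forall>w f w' f'.
        solves_inverse V A T \<beta> \<phi> \<psi> w f \<longrightarrow> solves_inverse V A T \<beta> \<phi> \<psi> w' f' \<longrightarrow>
        f = f' \<and> (\<forall>t\<in>{0..T}. w t = w' t)) \<and>
     (\<exists>C. \<forall>\<phi>\<in>V. \<forall>\<psi>\<in>V. \<forall>\<phi>'\<in>V. \<forall>\<psi>'\<in>V. \<forall>w f w' f'.
        solves_inverse V A T \<beta> \<phi> \<psi> w f \<longrightarrow> solves_inverse V A T \<beta> \<phi>' \<psi>' w' f' \<longrightarrow>
        norm (f - f') \<le> C * (norm (\<phi> - \<phi>') + norm (\<psi> - \<psi>')) \<and>
        (\<forall>t\<in>{0..T}. norm (w t - w' t) \<le> C * (norm (\<phi> - \<phi>') + norm (\<psi> - \<psi>'))))"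

end

theory Submission
  imports Defs
begin

text \<open>
  The error \<open>e\<close> of an iterate is propagated as follows. The difference \<open>z\<close> of the states satisfies
  \<open>z' + A z = \<beta> e\<close> and \<open>z 0 = 0\<close>, and since \<open>\<beta> T = 1\<close> the next error is \<open>z' T\<close>. The residual
  \<open>r = \<beta> e - A z\<close> equals \<open>z'\<close> and satisfies \<open>r' + A r = \<beta>' e\<close> with \<open>r 0 = \<beta> 0 e\<close>, so
  \<open>A \<ge> \<delta> I\<close> and \<open>\<beta>' \<ge> 0\<close> give
  \<open>\<parallel>r T\<parallel> \<le> (exp (-\<delta> T) \<beta> 0 + \<beta> T - \<beta> 0) \<parallel>e\<parallel>\<close>, where the factor is \<open>\<rho>\<close>.
\<close>

text \<open>Moving \<open>A\<close> to the other argument reduces linearity of \<open>A\<close> to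
  linearity of the inner product: both sides of each identity have the same inner product with every
  \<open>d\<close> in \<open>V\<close>, and testing with their difference, itself in
  \<open>V\<close>, makes them equal.\<close>

lemma symmetric_on_imp_linear_on:
  fixes A :: "'a::real_inner \<Rightarrow> 'a"
  assumes V: "subspace V" and A: "\<And>x. x \<in> V \<Longrightarrow> A x \<in> V"
    and sym: "\<And>x y. x \<in> V \<Longrightarrow> y \<in> V \<Longrightarrow> inner (A x) y = inner x (A y)"
    and x: "x \<in> V" and y: "y \<in> V"
  shows "A (x + y) = A x + A y" and "A (s *\<^sub>R x) = s *\<^sub>R A x"
proof -
  have eqI: "u = v" if "u \<in> V" "v \<in> V" "\<And>d. d \<in> V \<Longrightarrow> inner u d = inner v d" for u v
  proof -
    have "inner (u - v) (u - v) = 0"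
      using that(3)[OF subspace_diff[OF V that(1,2)]] by (simp add: inner_diff_left)
    then show ?thesis by simp
  qed
  show "A (x + y) = A x + A y"
    by (rule eqI) (simp_all add: sym inner_add_left A x y subspace_add[OF V])
  show "A (s *\<^sub>R x) = s *\<^sub>R A x"
    by (rule eqI) (simp_all add: sym A x subspace_scale[OF V])
qed

text \<open>\<open>L\<close> is \<open>A\<close> composed with the orthogonal projection onto
  \<open>V\<close>. A finite sum of bounded functionals times fixed vectors is bounded, so
  \<open>L\<close> is continuous on the whole space and commutes with derivatives.\<close>

lemma linear_on_finite_span_bounded_extension:
  fixes A :: "'a::real_inner \<Rightarrow> 'b::real_normed_vector"
  assumes B: "finite B" "span B = V"
    and add: "\<And>x y. x \<in> V \<Longrightarrow> y \<in> V \<Longrightarrow> A (x + y) = A x + A y"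
    and scale: "\<And>s x. x \<in> V \<Longrightarrow> A (s *\<^sub>R x) = s *\<^sub>R A x"
  obtains L where "bounded_linear L" "\<And>x. x \<in> V \<Longrightarrow> L x = A x"
proof -
  obtain C where C: "finite C" "span C = V" "pairwise orthogonal C"
    using basis_orthogonal[OF B(1)] B(2) by metis
  define L where "L x = (\<Sum>b\<in>C. (inner x b / inner b b) *\<^sub>R A b)" for x
  have "bounded_linear L"
    unfolding L_def by (intro bounded_linear_sum bounded_linear_scaleR_const
        bounded_linear_divide[THEN bounded_linear_compose] bounded_linear_inner_left)
  moreover have "L x = A x" if "x \<in> V" for x
  proof -
    have V: "subspace V" using C(2) subspace_span by metis
    have L_base: "L a = A a" if "a \<in> C" for a
    proof -
      have "(\<Sum>b\<in>C. (inner a b / inner b b) *\<^sub>R A b) = (\<Sum>b\<in>C. if b = a then A a else 0)"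
      proof (rule sum.cong)
        fix b assume b: "b \<in> C"
        show "(inner a b / inner b b) *\<^sub>R A b = (if b = a then A a else 0)"
        proof (cases "b = a")
          case True
          \<comment> \<open>The orthogonal set \<open>C\<close> may contain 0; there the coefficient
            0/0 has the value 0, which agrees with \<open>A 0 = 0\<close>.\<close>
          have "A 0 = 0" using scale[of 0 0] subspace_0[OF V] by simp
          then show ?thesis using True by (cases "a = 0") auto
        next
          case False
          then have "inner a b = 0"
            using C(3) b that by (auto simp: pairwise_def orthogonal_def)
          then show ?thesis using False by simp
        qed
      qed simp
      then show ?thesis using C(1) that by (simp add: L_def)
    qed
    have lin: "linear L" by (simp add: bounded_linear.linear \<open>bounded_linear L\<close>)
    have "x \<in> span C" using that C(2) by simp
    then have "x \<in> V \<and> L x = A x"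
    proof (induction rule: span_induct_alt)
      case base
      show ?case
        using scale[of 0 0] subspace_0[OF V] by (simp add: linear_0[OF lin])
    next
      case (step c a y)
      have "a \<in> V" using step(1) C(2) span_base by metis
      then show ?case
        using step L_base add scale
        by (simp add: linear_add[OF lin] linear_scale[OF lin] subspace_add[OF V]
            subspace_scale[OF V])
    qed
    then show ?thesis ..
  qed
  ultimately show ?thesis using that by blast
qed

text \<open>Formally the norm n of \<open>r\<close> satisfies n' \<le> \<beta>' K - \<delta> n, so
  exp(\<delta> t) (n - (\<beta> t - \<beta> 0) K) does not increase. Only the initial value gets the
  decay factor; the weight exp(-\<delta> (T - t)) on the source \<beta>' K is estimated by
  1.\<close>

lemma dissipative_norm_bound:
  fixes r :: "real \<Rightarrow> 'a::real_inner"
  assumes T: "0 \<le> T" and \<delta>: "0 \<le> \<delta>" and K: "0 \<le> K"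
    and r_cont: "continuous_on {0..T} r"
    and r_deriv: "\<And>t. 0 < t \<Longrightarrow> t < T \<Longrightarrow> (r has_vector_derivative r' t) (at t)"
    and diss: "\<And>t. 0 < t \<Longrightarrow> t < T \<Longrightarrow>
      inner (r t) (r' t) \<le> \<beta>' t * K * norm (r t) - \<delta> * (norm (r t))\<^sup>2"
    and \<beta>_cont: "continuous_on {0..T} \<beta>"
    and \<beta>_deriv: "\<And>t. 0 < t \<Longrightarrow> t < T \<Longrightarrow> (\<beta> has_real_derivative \<beta>' t) (at t)"
    and \<beta>'_nonneg: "\<And>t. 0 < t \<Longrightarrow> t < T \<Longrightarrow> 0 \<le> \<beta>' t"
  shows "norm (r T) \<le> exp (- \<delta> * T) * norm (r 0) + (\<beta> T - \<beta> 0) * K"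
proof -
  have \<beta>_mono: "\<beta> 0 \<le> \<beta> t" if "0 \<le> t" "t \<le> T" for t
  proof (rule DERIV_nonneg_imp_increasing_open[OF that(1)])
    show "\<exists>y. (\<beta> has_real_derivative y) (at x) \<and> 0 \<le> y" if "0 < x" "x < t" for x
      using \<beta>_deriv[of x] \<beta>'_nonneg[of x] that \<open>t \<le> T\<close> by force
    show "continuous_on {0..t} \<beta>"
      using \<beta>_cont by (rule continuous_on_subset) (use that in auto)
  qed
  \<comment> \<open>The norm is regularised, since it is not differentiable where \<open>r\<close> vanishes.\<close>
  have approx: "norm (r T) \<le> exp (- \<delta> * T) * norm (r 0) + (\<beta> T - \<beta> 0) * K + \<epsilon>"
    if \<epsilon>: "0 < \<epsilon>" for \<epsilon>
  proof -
    define s where "s t = sqrt ((norm (r t))\<^sup>2 + \<epsilon>\<^sup>2)" for t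
    \<comment> \<open>Subtracting \<epsilon> makes \<open>s - \<epsilon>\<close> vanish exactly
      where \<open>r\<close> does and keeps it below the norm of \<open>r\<close>, so the
      regularisation costs nothing at time 0.\<close>
    define h where "h t = exp (\<delta> * t) * (s t - \<epsilon> - (\<beta> t - \<beta> 0) * K)" for t
    have rad_pos: "0 < (norm (r t))\<^sup>2 + \<epsilon>\<^sup>2" for t
      using \<epsilon> by (simp add: add_nonneg_pos)
    then have s_pos: "0 < s t" for t
      by (simp add: s_def)
    have s_sq: "(s t)\<^sup>2 = (norm (r t))\<^sup>2 + \<epsilon>\<^sup>2" for t
      by (simp add: s_def)
    have s_norm: "norm (r t) \<le> s t" for t
      by (simp add: s_def)
    have s_eps: "\<epsilon> \<le> s t" for t
      by (simp add: s_def)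
    have "h T \<le> h 0"
    proof (rule DERIV_nonpos_imp_decreasing_open[OF T])
      show "continuous_on {0..T} h"
        unfolding h_def s_def by (intro continuous_intros r_cont \<beta>_cont)
      fix t assume t: "0 < t" "t < T"
      define s' where "s' = inner (r t) (r' t) / s t"
      have "((\<lambda>t. (norm (r t))\<^sup>2 + \<epsilon>\<^sup>2) has_real_derivative 2 * inner (r t) (r' t)) (at t)"
      proof -
        note d = r_deriv[OF t, unfolded has_vector_derivative_def]
        have "((\<lambda>t. inner (r t) (r t)) has_real_derivative 2 * inner (r t) (r' t)) (at t)"
          unfolding has_field_derivative_def
          by (rule has_derivative_eq_rhs[OF has_derivative_inner[OF d d]])
            (auto simp: inner_commute)
        then show ?thesis
          by (auto simp: power2_norm_eq_inner intro!: derivative_eq_intros)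
      qed
      then have s_deriv: "(s has_real_derivative s') (at t)"
        unfolding s_def s'_def
        by (rule DERIV_chain2[where f = sqrt and g = "\<lambda>t. (norm (r t))\<^sup>2 + \<epsilon>\<^sup>2" and x = t,
              OF DERIV_real_sqrt[OF rad_pos], THEN DERIV_cong])
          (simp add: field_simps)
      have h_deriv: "(h has_real_derivative exp (\<delta> * t) *
          (\<delta> * (s t - \<epsilon> - (\<beta> t - \<beta> 0) * K) + (s' - \<beta>' t * K))) (at t)"
        unfolding h_def
        by (rule derivative_eq_intros s_deriv \<beta>_deriv[OF t] refl)+ (simp add: algebra_simps)
      have "s' \<le> \<beta>' t * K - \<delta> * (s t - \<epsilon>)"
      proof -
        have "inner (r t) (r' t) \<le> \<beta>' t * K * norm (r t) - \<delta> * ((s t)\<^sup>2 - \<epsilon>\<^sup>2)"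
          using diss[OF t] s_sq[of t] by simp
        \<comment> \<open>Here \<epsilon> \<le> \<open>s t\<close> turns \<epsilon>^2 into
          \<epsilon> \<open>s t\<close>, so that \<open>s t\<close> becomes a common factor and
          cancels the denominator of \<open>s'\<close>.\<close>
        also have "\<dots> \<le> \<beta>' t * K * s t - \<delta> * ((s t)\<^sup>2 - \<epsilon> * s t)"
          using s_norm[of t] s_eps[of t] K \<beta>'_nonneg[OF t] \<delta> \<epsilon>
          by (intro diff_mono mult_left_mono) (auto simp: power2_eq_square)
        also have "\<dots> = (\<beta>' t * K - \<delta> * (s t - \<epsilon>)) * s t"
          by (simp add: algebra_simps power2_eq_square)
        finally show ?thesis
          using s_pos[of t] by (simp add: s'_def divide_le_eq)
      qed
      \<comment> \<open>This is the term left over in the derivative of \<open>h\<close> after the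
        bound on \<open>s'\<close>; it enters with a minus sign, and its own sign comes from the
        monotonicity of \<beta>.\<close>
      moreover have "0 \<le> \<delta> * ((\<beta> t - \<beta> 0) * K)"
        using \<beta>_mono[of t] t \<delta> K by simp
      ultimately have "\<delta> * (s t - \<epsilon> - (\<beta> t - \<beta> 0) * K) + (s' - \<beta>' t * K) \<le> 0"
        by (simp add: algebra_simps)
      then show "\<exists>y. (h has_real_derivative y) (at t) \<and> y \<le> 0"
        using h_deriv by (meson exp_ge_zero mult_nonneg_nonpos)
    qed
    then have "exp (\<delta> * T) * (s T - \<epsilon> - (\<beta> T - \<beta> 0) * K) \<le> s 0 - \<epsilon>"
      by (simp add: h_def)
    also have "\<dots> \<le> norm (r 0)"
      using sqrt_sum_squares_le_sum[of "norm (r 0)" \<epsilon>] \<epsilon> by (simp add: s_def)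
    finally have "s T - \<epsilon> - (\<beta> T - \<beta> 0) * K \<le> exp (- \<delta> * T) * norm (r 0)"
      by (simp add: exp_minus field_simps)
    with s_norm[of T] show ?thesis by linarith
  qed
  show ?thesis by (rule field_le_epsilon) (rule approx)
qed

text \<open>The residual is differentiable at interior times because \<beta> and \<open>z\<close>
  are and \<open>L\<close> is bounded, so its equation is obtained without a second derivative of
  \<open>z\<close>. Continuity reaches time 0, where the evolution equation is not imposed.\<close>

lemma residual_bound:
  fixes z :: "real \<Rightarrow> 'a::real_inner"
  assumes T: "0 < T" and \<delta>: "0 \<le> \<delta>"
    and L: "bounded_linear L" and V: "subspace V" and LV: "\<And>x. x \<in> V \<Longrightarrow> L x \<in> V"
    and coercive: "\<And>x. x \<in> V \<Longrightarrow> \<delta> * (norm x)\<^sup>2 \<le> inner (L x) x"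
    and e: "e \<in> V" and zV: "\<And>t. t \<in> {0..T} \<Longrightarrow> z t \<in> V"
    and z_cont: "continuous_on {0..T} z" and z0: "z 0 = 0"
    and z_deriv: "\<And>t. t \<in> {0<..T} \<Longrightarrow>
      (z has_vector_derivative \<beta> t *\<^sub>R e - L (z t)) (at t within {0..T})"
    and \<beta>_deriv: "\<And>t. t \<in> {0..T} \<Longrightarrow> (\<beta> has_real_derivative \<beta>' t) (at t within {0..T})"
    and \<beta>: "0 \<le> \<beta> 0" "\<And>t. t \<in> {0..T} \<Longrightarrow> 0 \<le> \<beta>' t"
  shows "norm (\<beta> T *\<^sub>R e - L (z T)) \<le> (\<beta> T - \<beta> 0 * (1 - exp (- \<delta> * T))) * norm e"
proof -
  define r where "r t = \<beta> t *\<^sub>R e - L (z t)" for t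
  have \<beta>_cont: "continuous_on {0..T} \<beta>"
    using \<beta>_deriv by (rule DERIV_continuous_on)
  have "norm (r T) \<le> exp (- \<delta> * T) * norm (r 0) + (\<beta> T - \<beta> 0) * norm e"
  proof (rule dissipative_norm_bound)
    show "continuous_on {0..T} r"
      unfolding r_def
      by (intro continuous_intros \<beta>_cont bounded_linear.continuous_on[OF L] z_cont)
    fix t assume t: "0 < t" "t < T"
    then show \<beta>t: "(\<beta> has_real_derivative \<beta>' t) (at t)"
      using \<beta>_deriv[of t] by (simp add: at_within_Icc_at)
    have "(z has_vector_derivative r t) (at t)"
      using z_deriv[of t] t by (simp add: r_def at_within_Icc_at)
    then have "((\<lambda>t. L (z t)) has_vector_derivative L (r t)) (at t)"
      by (rule bounded_linear.has_vector_derivative[OF L])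
    then show "(r has_vector_derivative \<beta>' t *\<^sub>R e - L (r t)) (at t)"
      unfolding r_def
      by (rule has_vector_derivative_diff[rotated])
        (use has_vector_derivative_scaleR[OF \<beta>t has_vector_derivative_const, of e] in simp)
    have "r t \<in> V"
      unfolding r_def using t by (intro subspace_diff subspace_scale V LV zV e) auto
    then have "\<delta> * (norm (r t))\<^sup>2 \<le> inner (L (r t)) (r t)"
      by (rule coercive)
    moreover have "\<beta>' t * inner (r t) e \<le> \<beta>' t * (norm (r t) * norm e)"
      using \<beta>(2)[of t] t by (intro mult_left_mono norm_cauchy_schwarz) auto
    ultimately show "inner (r t) (\<beta>' t *\<^sub>R e - L (r t))
        \<le> \<beta>' t * norm e * norm (r t) - \<delta> * (norm (r t))\<^sup>2"
      by (simp add: inner_diff_right inner_commute mult.commute mult.left_commute)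
    show "0 \<le> \<beta>' t" using \<beta>(2)[of t] t by simp
  qed (use T \<delta> \<beta>_cont in auto)
  moreover have "r 0 = \<beta> 0 *\<^sub>R e"
    by (simp add: r_def z0 linear_0[OF bounded_linear.linear[OF L]])
  ultimately show ?thesis
    using \<beta>(1) by (simp add: r_def algebra_simps)
qed

text \<open>Symmetry is visible in the integrands, whatever the weak gradients and traces are. It
  makes \<open>A\<close> self-adjoint on \<open>Vh\<close> and, through
  \<open>symmetric_on_imp_linear_on\<close>, linear there.\<close>

lemma form_commute: "form vs k c \<mu> u v = form vs k c \<mu> v u"
  by (simp add: form_def inner_commute mult.commute mult.left_commute)

lemma LIMSEQ_of_linear_rate:
  fixes x :: "nat \<Rightarrow> 'a::real_normed_vector"
  assumes \<rho>: "0 \<le> \<rho>" "\<rho> < 1"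
    and rate: "\<And>n. norm (x (Suc n) - l) \<le> \<rho> * norm (x n - l)"
  shows "x \<longlonglongrightarrow> l"
proof -
  have "norm (x n - l) \<le> \<rho> ^ n * norm (x 0 - l)" for n
  proof (induction n)
    case (Suc n)
    have "norm (x (Suc n) - l) \<le> \<rho> * (\<rho> ^ n * norm (x 0 - l))"
      using rate[of n] mult_left_mono[OF Suc \<rho>(1)] by linarith
    then show ?case by (simp add: mult.assoc)
  qed simp
  then have bound: "\<forall>\<^sub>F n in sequentially. norm (x n - l) \<le> \<rho> ^ n * norm (x 0 - l)"
    by simp
  have "(\<lambda>n. \<rho> ^ n) \<longlonglongrightarrow> 0"
    using \<rho> by (intro LIMSEQ_power_zero) simp
  then have "(\<lambda>n. \<rho> ^ n * norm (x 0 - l)) \<longlonglongrightarrow> 0"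
    by (rule tendsto_mult_left_zero)
  with bound have "(\<lambda>n. x n - l) \<longlonglongrightarrow> 0"
    by (rule Lim_null_comparison)
  then show ?thesis by (simp add: LIM_zero_iff)
qed

lemma solves_evolutionD:
  assumes "solves_evolution V A T \<beta> f \<phi> w"
  shows "\<And>t. t \<in> {0..T} \<Longrightarrow> w t \<in> V" and "continuous_on {0..T} w" and "w 0 = \<phi>"
    and "\<And>t. t \<in> {0<..T} \<Longrightarrow>
      (w has_vector_derivative \<beta> t *\<^sub>R f - A (w t)) (at t within {0..T})"
proof -
  fix t assume "t \<in> {0<..T}"
  then obtain w' where "(w has_vector_derivative w') (at t within {0..T})"
    "w' + A (w t) = \<beta> t *\<^sub>R f"
    using assms unfolding solves_evolution_def by blast
  then show "(w has_vector_derivative \<beta> t *\<^sub>R f - A (w t)) (at t within {0..T})"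
    by (metis add_diff_cancel_right')
qed (use assms in \<open>auto simp: solves_evolution_def\<close>)

theorem theorem4:
  fixes vs :: "(real^2) list" and \<Omega> :: "(real^2) set"
    and k c \<mu> :: "real^2 \<Rightarrow> real" and k1 k2 \<mu>1 \<delta> T :: real
    and Vh :: "l2 set" and A :: "l2 \<Rightarrow> l2"
    and \<beta> \<beta>' :: "real \<Rightarrow> real"
    and \<phi> \<psi> \<phi>sol :: l2 and w :: "real \<Rightarrow> l2"
    and \<phi>it :: "nat \<Rightarrow> l2" and wit :: "nat \<Rightarrow> real \<Rightarrow> l2"
    and \<rho> :: real
  assumes polygon: "simple_polygon vs" and Omega: "\<Omega> = polygon_interior vs"
    and k_measurable: "set_borel_measurable lebesgue \<Omega> k"
    and k_bounds: "0 < k1" "\<forall>x\<in>\<Omega>. k1 \<le> k x \<and> k x \<le> k2"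
    and c_measurable: "set_borel_measurable lebesgue \<Omega> c"
    and c_nonneg: "\<forall>x\<in>\<Omega>. 0 \<le> c x"
    and mu_measurable: "set_borel_measurable (boundary_measure vs) (frontier \<Omega>) \<mu>"
    and mu_bound: "0 < \<mu>1" "\<forall>x\<in>frontier \<Omega>. \<mu>1 \<le> \<mu> x"
    and Vh: "subspace Vh" "\<exists>B. finite B \<and> span B = Vh" "Vh \<subseteq> H1 \<Omega>"
    and well_defined: "\<forall>u\<in>Vh. \<forall>v\<in>Vh. form_integrable vs k c \<mu> u v"
    and A: "\<forall>y\<in>Vh. A y \<in> Vh" "\<forall>y\<in>Vh. \<forall>v\<in>Vh. inner (A y) v = form vs k c \<mu> y v"
    and delta: "0 < \<delta>" "\<forall>u\<in>Vh. form vs k c \<mu> u u \<ge> \<delta> * (norm u)\<^sup>2"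
    and T: "0 < T"
    and beta_deriv: "\<forall>t\<in>{0..T}. (\<beta> has_real_derivative \<beta>' t) (at t within {0..T})"
    and beta: "\<forall>t\<in>{0..T}. 0 < \<beta> t" "\<forall>t\<in>{0..T}. 0 \<le> \<beta>' t" "\<beta> T = 1"
    and well_posed: "well_posed_inverse Vh A T \<beta>"
    and data: "\<phi> \<in> Vh" "\<psi> \<in> Vh"
    and inverse: "solves_inverse Vh A T \<beta> \<phi> \<psi> w \<phi>sol"
    and start: "\<phi>it 0 \<in> Vh"
    and iterate_w: "\<forall>n. solves_evolution Vh A T \<beta> (\<phi>it n) \<phi> (wit n)"
    and iterate_phi: "\<forall>n. \<phi>it (Suc n) = vector_derivative (wit n) (at T within {0..T}) + A \<psi>"
    and rho: "\<rho> = 1 - \<beta> 0 * (1 - exp (- \<delta> * T))"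
  shows "0 < \<rho> \<and> \<rho> < 1 \<and> \<phi>it \<longlonglongrightarrow> \<phi>sol \<and>
    (\<forall>n. norm (\<phi>it (Suc n) - \<phi>sol) \<le> \<rho> * norm (\<phi>it n - \<phi>sol))"
proof -

  \<comment> \<open>Linearity of the operator and its bounded extension\<close>
  have A_sym: "inner (A x) y = inner x (A y)" if "x \<in> Vh" "y \<in> Vh" for x y
    using A(2) that form_commute[of vs k c \<mu> x y] by (simp add: inner_commute)
  have A_add: "A (x + y) = A x + A y" if "x \<in> Vh" "y \<in> Vh" for x y
    using A(1) A_sym that by (intro symmetric_on_imp_linear_on[OF Vh(1)]) auto
  have A_scale: "A (s *\<^sub>R x) = s *\<^sub>R A x" if "x \<in> Vh" for s x
    using A(1) A_sym that by (intro symmetric_on_imp_linear_on(2)[OF Vh(1)]) auto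
  obtain B where B: "finite B" "span B = Vh" using Vh(2) by blast
  \<comment> \<open>\<open>A\<close> is arbitrary outside \<open>Vh\<close>; passing to
    \<open>L\<close> gives an operator to which the calculus of bounded linear maps applies.\<close>
  obtain L where L: "bounded_linear L" and L_eq: "\<And>x. x \<in> Vh \<Longrightarrow> L x = A x"
    using linear_on_finite_span_bounded_extension[OF B A_add A_scale] by metis
  interpret L: bounded_linear L by (rule L)

  \<comment> \<open>Explicit form of the iteration\<close>
  have w: "solves_evolution Vh A T \<beta> \<phi>sol \<phi> w" "w T = \<psi>" "\<phi>sol \<in> Vh"
    using inverse by (auto simp: solves_inverse_def)
  have step: "\<phi>it (Suc n) = \<phi>it n - A (wit n T) + A \<psi>" for n
  proof -
    \<comment> \<open>The one-sided derivative at T is unique because T > 0 makes T a limit point of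
      the interval, so \<open>vector_derivative\<close> returns the value given by the
      equation.\<close>
    have "vector_derivative (wit n) (at T within {0..T}) = \<beta> T *\<^sub>R \<phi>it n - A (wit n T)"
      using solves_evolutionD(4)[OF iterate_w[rule_format, of n]] T
      by (intro vector_derivative_within) (auto simp: trivial_limit_within islimpt_Icc)
    then show ?thesis using iterate_phi beta(3) by simp
  qed
  \<comment> \<open>Coercivity and the agreement of \<open>L\<close> with \<open>A\<close> hold on
    \<open>Vh\<close>, so the errors must stay there.\<close>
  have it_Vh: "\<phi>it n \<in> Vh" for n
  proof (induction n)
    case (Suc n)
    have "wit n T \<in> Vh"
      using solves_evolutionD(1)[OF iterate_w[rule_format, of n]] T by simp
    then show ?case
      unfolding step using Suc A(1) data(2) by (intro subspace_add subspace_diff Vh(1)) auto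
  qed (rule start)

  \<comment> \<open>Contraction of the error\<close>
  have rate: "norm (\<phi>it (Suc n) - \<phi>sol) \<le> \<rho> * norm (\<phi>it n - \<phi>sol)" for n
  proof -
    note wn = solves_evolutionD[OF iterate_w[rule_format, of n]]
    note ws = solves_evolutionD[OF w(1)]
    define z where "z t = wit n t - w t" for t
    define e where "e = \<phi>it n - \<phi>sol"
    have z_Vh: "z t \<in> Vh" if "t \<in> {0..T}" for t
      unfolding z_def using wn(1) ws(1) that by (intro subspace_diff Vh(1)) auto
    have Lz: "L (z t) = A (wit n t) - A (w t)" if "t \<in> {0..T}" for t
      using L_eq wn(1) ws(1) that by (simp add: z_def L.diff)
    have "norm (\<beta> T *\<^sub>R e - L (z T)) \<le> (\<beta> T - \<beta> 0 * (1 - exp (- \<delta> * T))) * norm e"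
    proof (rule residual_bound[OF T _ L Vh(1)])
      show "\<delta> * (norm x)\<^sup>2 \<le> inner (L x) x" if "x \<in> Vh" for x
        using delta(2) A(2) L_eq that by simp
      show "e \<in> Vh"
        unfolding e_def by (intro subspace_diff Vh(1) it_Vh w(3))
      show "continuous_on {0..T} z"
        unfolding z_def by (intro continuous_on_diff wn(2) ws(2))
      fix t assume t: "t \<in> {0<..T}"
      have "\<beta> t *\<^sub>R e - L (z t)
          = (\<beta> t *\<^sub>R \<phi>it n - A (wit n t)) - (\<beta> t *\<^sub>R \<phi>sol - A (w t))"
        using Lz[of t] t by (simp add: e_def scaleR_diff_right)
      then show "(z has_vector_derivative \<beta> t *\<^sub>R e - L (z t)) (at t within {0..T})"
        unfolding z_def by (simp only:) (rule has_vector_derivative_diff[OF wn(4)[OF t] ws(4)[OF t]])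
    next
      show "L x \<in> Vh" if "x \<in> Vh" for x
        using A(1) L_eq that by simp
      show "z 0 = 0"
        using wn(3) ws(3) by (simp add: z_def)
      show "0 \<le> \<beta> 0" "0 \<le> \<delta>"
        using beta(1) T delta(1) by (simp_all add: less_imp_le)
    qed (use z_Vh beta_deriv beta(2) in blast)+
    \<comment> \<open>As \<psi> = \<open>w T\<close>, the terms \<open>A (wit n T)\<close> and
      \<open>A \<psi>\<close> combine to \<open>L (z T)\<close>; with \<beta> T = 1 the new error is
      the residual at T.\<close>
    moreover have "\<phi>it (Suc n) - \<phi>sol = \<beta> T *\<^sub>R e - L (z T)"
      using Lz[of T] T beta(3) w(2) by (simp add: step e_def)
    ultimately show ?thesis
      by (simp only: rho e_def beta(3))
  qed

  \<comment> \<open>Range of the rate and convergence\<close>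
  have \<beta>0: "0 < \<beta> 0" "\<beta> 0 \<le> 1"
  proof -
    show "0 < \<beta> 0" using beta(1) T by simp
    have "\<beta> 0 \<le> \<beta> T"
    proof (rule DERIV_nonneg_imp_increasing_open[where f = \<beta>])
      show "\<exists>y. (\<beta> has_real_derivative y) (at x) \<and> 0 \<le> y" if "0 < x" "x < T" for x
        using beta_deriv[rule_format, of x] beta(2) that
        by (intro exI[of _ "\<beta>' x"]) (simp add: at_within_Icc_at)
      show "continuous_on {0..T} \<beta>"
        using beta_deriv by (intro DERIV_continuous_on) auto
    qed (use T in simp)
    then show "\<beta> 0 \<le> 1" using beta(3) by simp
  qed
  have E: "0 < exp (- \<delta> * T)" "exp (- \<delta> * T) < 1"
    using delta(1) T by auto
  \<comment> \<open>From \<beta> 0 \<le> 1 follows \<rho> \<ge> exp(-\<delta> T) > 0, while \<beta>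
    0 > 0 and \<delta> T > 0 give \<rho> < 1.\<close>
  have "\<beta> 0 * (1 - exp (- \<delta> * T)) \<le> 1 - exp (- \<delta> * T)"
    using \<beta>0 E by (intro mult_left_le_one_le) auto
  moreover have "0 < \<beta> 0 * (1 - exp (- \<delta> * T))"
    using \<beta>0 E by simp
  ultimately have \<rho>: "0 < \<rho>" "\<rho> < 1"
    using E unfolding rho by linarith+
  have "\<phi>it \<longlonglongrightarrow> \<phi>sol"
    using \<rho> rate by (intro LIMSEQ_of_linear_rate[where \<rho> = \<rho>]) auto
  with \<rho> rate show ?thesis by blast
qed

end
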